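(* Let $\Omega$ be a biased graph. Then $\Omega$ is regular (that is, $\Gamma$-gainable for every non-trivial group $\Gamma$) if and only if $\Omega$ is $\mathbb{Z}_2$-gainable and $\mathbb{Z}_3$-gainable.
   Context: Graphs are finite and may have loops and parallel edges. A cycle of a graph is a nonempty connected subgraph in which every vertex has degree $2$ (so a loop is a 1-edge cycle and two parallel edges form a 2-edge cycle). A theta subgraph consists of two distinct vertices and three internally disjoint paths joining them. A biased graph is a pair $\Omega=(G,\mathcal{B})$ where $G$ is a graph and $\mathcal{B}$ is a set of cycles of $G$ (called balanced) such that no theta subgraph of $G$ contains exactly two cycles in $\mathcal{B}$. An arc of $G$ is a triple $(e,u,v)$, where $e$ is an edge, $u,v$ are vertices incident with $e$, and $u\neq v$ if $e$ is not a loop. For a group $\Gamma$, a $\Gamma$-gaining of $G$ is a function $\gamma$ from the arcs of $G$ to $\Gamma$ with $\gamma(e,v,u)=\gamma(e,u,v)^{-1}$ for every non-loop edge $e$. The gain of a walk $u_0,e_0,u_1,\ldots,e_{n-1},u_n$ is $\gamma(e_0,u_0,u_1)\cdots\gamma(e_{n-1},u_{n-1},u_n)$. A simple closed walk of a cycle is a closed walk traversing the cycle exactly once; whether its gain is the identity does not depend on starting vertex or direction. Let $\mathcal{B}_\gamma$ be the set of cycles whose simple closed walks have identity gain. $(G,\mathcal{B})$ is $\Gamma$-gainable if there is a $\Gamma$-gaining $\gamma$ of $G$ with $\mathcal{B}=\mathcal{B}_\gamma$. $\mathbb{Z}_n$ is the cyclic group of order $n$. *)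

theory Defs
  imports "HOL-Algebra.Elementary_Groups" "HOL-Library.Infinite_Typeclass"
begin

record ('v, 'e) graph =
  verts :: "'v set"
  edges :: "'e set"
  ends :: "'e \<Rightarrow> 'v set"

text \<open>An edge \<open>e\<close> is a loop exactly when \<open>ends G e\<close> is a singleton.\<close>

locale multigraph =
  fixes G :: "('v, 'e) graph"
  assumes finite_verts: "finite (verts G)"
    and finite_edges: "finite (edges G)"
    and ends_subset: "e \<in> edges G \<Longrightarrow> ends G e \<subseteq> verts G"
    and card_ends: "e \<in> edges G \<Longrightarrow> card (ends G e) \<in> {1, 2}"

definition loop :: "('v, 'e) graph \<Rightarrow> 'e \<Rightarrow> bool" where
  "loop G e \<longleftrightarrow> e \<in> edges G \<and> card (ends G e) = 1"

text \<open>The incidence map of a subgraph is required to be the same total function as that of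
  \<open>G\<close>, also outside the edge set, so that a subgraph is determined by its vertices and edges.\<close>

definition subgraph :: "('v, 'e) graph \<Rightarrow> ('v, 'e) graph \<Rightarrow> bool" where
  "subgraph H G \<longleftrightarrow> multigraph H \<and> verts H \<subseteq> verts G \<and> edges H \<subseteq> edges G \<and> ends H = ends G"

text \<open>A loop contributes 2 to the degree of its vertex.\<close>

definition degree :: "('v, 'e) graph \<Rightarrow> 'v \<Rightarrow> nat" where
  "degree G v = card {e \<in> edges G. v \<in> ends G e} + card {e. loop G e \<and> v \<in> ends G e}"

definition arcs :: "('v, 'e) graph \<Rightarrow> ('e \<times> 'v \<times> 'v) set" where
  "arcs G = {(e, u, v). e \<in> edges G \<and> u \<in> ends G e \<and> v \<in> ends G e \<and> (\<not> loop G e \<longrightarrow> u \<noteq> v)}"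

text \<open>The walk \<open>u\<^sub>0, e\<^sub>0, u\<^sub>1, \<dots>, u\<^sub>n\<close> is represented by its first vertex \<open>u\<^sub>0\<close>, its last vertex
  \<open>u\<^sub>n\<close>, and the list of its arcs \<open>(e\<^sub>i, u\<^sub>i, u\<^sub>i\<^sub>+\<^sub>1)\<close>.\<close>

fun walk :: "('v, 'e) graph \<Rightarrow> 'v \<Rightarrow> ('e \<times> 'v \<times> 'v) list \<Rightarrow> 'v \<Rightarrow> bool" where
  "walk G u [] w \<longleftrightarrow> u \<in> verts G \<and> u = w"
| "walk G u ((e, x, y) # p) w \<longleftrightarrow> u = x \<and> (e, x, y) \<in> arcs G \<and> walk G y p w"

definition walk_verts :: "'v \<Rightarrow> ('e \<times> 'v \<times> 'v) list \<Rightarrow> 'v list" where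
  "walk_verts u p = u # map (\<lambda>(e, x, y). y) p"

definition walk_edges :: "('e \<times> 'v \<times> 'v) list \<Rightarrow> 'e list" where
  "walk_edges p = map (\<lambda>(e, x, y). e) p"

definition connected_graph :: "('v, 'e) graph \<Rightarrow> bool" where
  "connected_graph G \<longleftrightarrow> (\<forall>u \<in> verts G. \<forall>v \<in> verts G. \<exists>p. walk G u p v)"

definition cycle :: "('v, 'e) graph \<Rightarrow> ('v, 'e) graph \<Rightarrow> bool" where
  "cycle G C \<longleftrightarrow> subgraph C G \<and> verts C \<noteq> {} \<and> connected_graph C \<and> (\<forall>v \<in> verts C. degree C v = 2)"

definition path :: "('v, 'e) graph \<Rightarrow> 'v \<Rightarrow> ('e \<times> 'v \<times> 'v) list \<Rightarrow> 'v \<Rightarrow> bool" where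
  "path G u p w \<longleftrightarrow> walk G u p w \<and> distinct (walk_verts u p)"

text \<open>Edge-disjointness only excludes using one and the same one-edge path twice.\<close>

definition internally_disjoint ::
    "'v \<Rightarrow> 'v \<Rightarrow> ('e \<times> 'v \<times> 'v) list \<Rightarrow> ('e \<times> 'v \<times> 'v) list \<Rightarrow> bool" where
  "internally_disjoint u w p q \<longleftrightarrow>
     set (walk_verts u p) \<inter> set (walk_verts u q) = {u, w} \<and>
     set (walk_edges p) \<inter> set (walk_edges q) = {}"

definition theta :: "('v, 'e) graph \<Rightarrow> ('v, 'e) graph \<Rightarrow> bool" where
  "theta G T \<longleftrightarrow> subgraph T G \<and>
     (\<exists>u w p q r. u \<noteq> w \<and> path T u p w \<and> path T u q w \<and> path T u r w \<and>
        internally_disjoint u w p q \<and> internally_disjoint u w p r \<and> internally_disjoint u w q r \<and>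
        verts T = set (walk_verts u p) \<union> set (walk_verts u q) \<union> set (walk_verts u r) \<and>
        edges T = set (walk_edges p) \<union> set (walk_edges q) \<union> set (walk_edges r))"

locale biased_graph = multigraph G for G :: "('v, 'e) graph" +
  fixes B :: "('v, 'e) graph set"
  assumes balanced_cycle: "C \<in> B \<Longrightarrow> cycle G C"
    and theta_property: "theta G T \<Longrightarrow> card {C \<in> B. subgraph C T} \<noteq> 2"

definition gaining ::
    "('g, 'm) monoid_scheme \<Rightarrow> ('v, 'e) graph \<Rightarrow> ('e \<times> 'v \<times> 'v \<Rightarrow> 'g) \<Rightarrow> bool" where
  "gaining \<Gamma> G \<gamma> \<longleftrightarrow> \<gamma> \<in> arcs G \<rightarrow> carrier \<Gamma> \<and>
     (\<forall>e u v. (e, u, v) \<in> arcs G \<longrightarrow> \<not> loop G e \<longrightarrow> \<gamma> (e, v, u) = inv\<^bsub>\<Gamma>\<^esub> \<gamma> (e, u, v))"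

definition gain ::
    "('g, 'm) monoid_scheme \<Rightarrow> ('e \<times> 'v \<times> 'v \<Rightarrow> 'g) \<Rightarrow> ('e \<times> 'v \<times> 'v) list \<Rightarrow> 'g" where
  "gain \<Gamma> \<gamma> p = foldr (\<lambda>a x. \<gamma> a \<otimes>\<^bsub>\<Gamma>\<^esub> x) p \<one>\<^bsub>\<Gamma>\<^esub>"

text \<open>In a cycle, a closed walk using every edge exactly once also visits every vertex exactly
  once.\<close>

definition simple_closed_walk ::
    "('v, 'e) graph \<Rightarrow> 'v \<Rightarrow> ('e \<times> 'v \<times> 'v) list \<Rightarrow> bool" where
  "simple_closed_walk C u p \<longleftrightarrow>
     walk C u p u \<and> distinct (walk_edges p) \<and> set (walk_edges p) = edges C"

definition gain_balanced ::
    "('g, 'm) monoid_scheme \<Rightarrow> ('v, 'e) graph \<Rightarrow> ('e \<times> 'v \<times> 'v \<Rightarrow> 'g) \<Rightarrow> ('v, 'e) graph set" where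
  "gain_balanced \<Gamma> G \<gamma> =
     {C. cycle G C \<and> (\<forall>u p. simple_closed_walk C u p \<longrightarrow> gain \<Gamma> \<gamma> p = \<one>\<^bsub>\<Gamma>\<^esub>)}"

definition gainable ::
    "('g, 'm) monoid_scheme \<Rightarrow> ('v, 'e) graph \<Rightarrow> ('v, 'e) graph set \<Rightarrow> bool" where
  "gainable \<Gamma> G B \<longleftrightarrow> (\<exists>\<gamma>. gaining \<Gamma> G \<gamma> \<and> B = gain_balanced \<Gamma> G \<gamma>)"

text \<open>HOL cannot quantify over the groups on all types inside a formula, so regularity is
  relative to the type \<open>'g\<close> of group elements. The lemma \<open>regular_imp_gainable\<close> below shows that
  nothing is lost by considering infinite types only; the restriction is needed because a type
  with fewer than three elements carries no copy of the cyclic group of order 3.\<close>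

definition regular ::
    "'g::infinite itself \<Rightarrow> ('v, 'e) graph \<Rightarrow> ('v, 'e) graph set \<Rightarrow> bool" where
  "regular (_ :: 'g itself) G B \<longleftrightarrow>
     (\<forall>\<Gamma> :: 'g monoid. group \<Gamma> \<and> \<not> trivial_group \<Gamma> \<longrightarrow> gainable \<Gamma> G B)"

lemma subgraph_arcs: "subgraph H G \<Longrightarrow> arcs H \<subseteq> arcs G"
  by (auto simp: subgraph_def arcs_def loop_def)

lemma walk_arcs: "walk G u p w \<Longrightarrow> set p \<subseteq> arcs G"
  by (induction G u p w rule: walk.induct) auto

lemma gainable_iso:
  assumes "group \<Gamma>" "group \<Delta>" and h: "h \<in> iso \<Gamma> \<Delta>" and "gainable \<Gamma> G B"
  shows "gainable \<Delta> G B"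
proof -
  interpret \<Gamma>: group \<Gamma> by fact
  interpret \<Delta>: group \<Delta> by fact
  interpret group_hom \<Gamma> \<Delta> h
    using h by (unfold_locales) (auto simp: iso_def)
  have inj: "inj_on h (carrier \<Gamma>)"
    using h by (auto simp: iso_def bij_betw_def)
  obtain \<gamma> where \<gamma>: "gaining \<Gamma> G \<gamma>" and B: "B = gain_balanced \<Gamma> G \<gamma>"
    using assms(4) by (auto simp: gainable_def)
  have car: "\<gamma> a \<in> carrier \<Gamma>" if "a \<in> arcs G" for a
    using \<gamma> that by (auto simp: gaining_def)
  have gain_h: "gain \<Gamma> \<gamma> p \<in> carrier \<Gamma> \<and> gain \<Delta> (h \<circ> \<gamma>) p = h (gain \<Gamma> \<gamma> p)"
    if "set p \<subseteq> arcs G" for p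
    using that by (induction p) (auto simp: gain_def car)
  have gain1: "gain \<Delta> (h \<circ> \<gamma>) p = \<one>\<^bsub>\<Delta>\<^esub> \<longleftrightarrow> gain \<Gamma> \<gamma> p = \<one>\<^bsub>\<Gamma>\<^esub>"
    if "cycle G C" "simple_closed_walk C u p" for C u p
  proof -
    have "set p \<subseteq> arcs G"
      using that walk_arcs[of C u p u] subgraph_arcs[of C G]
      by (auto simp: cycle_def simple_closed_walk_def)
    then show ?thesis
      using gain_h[of p] inj by (metis \<Gamma>.one_closed hom_one inj_onD)
  qed
  have "gaining \<Delta> G (h \<circ> \<gamma>)"
    using \<gamma> car by (auto simp: gaining_def)
  moreover have "B = gain_balanced \<Delta> G (h \<circ> \<gamma>)"
    unfolding B gain_balanced_def using gain1 by blast
  ultimately show ?thesis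
    by (auto simp: gainable_def)
qed

lemma regular_imp_gainable:
  fixes \<Gamma> :: "'h monoid"
  assumes "regular TYPE('h list) G B" "group \<Gamma>" "\<not> trivial_group \<Gamma>"
  shows "gainable \<Gamma> G B"
proof -
  interpret \<Gamma>: group \<Gamma> by fact
  define \<Delta> :: "'h list monoid" where
    "\<Delta> = \<lparr>carrier = (\<lambda>x. [x]) ` carrier \<Gamma>, monoid.mult = (\<lambda>x y. [hd x \<otimes>\<^bsub>\<Gamma>\<^esub> hd y]), one = [\<one>\<^bsub>\<Gamma>\<^esub>]\<rparr>"
  have iso: "(\<lambda>x. [x]) \<in> iso \<Gamma> \<Delta>"
    by (auto simp: iso_def hom_def bij_betw_def inj_on_def \<Delta>_def)
  have "group (\<Delta>\<lparr>one := [\<one>\<^bsub>\<Gamma>\<^esub>]\<rparr>)"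
    using \<Gamma>.iso_imp_img_group[OF iso] .
  then have \<Delta>: "group \<Delta>"
    by (simp add: \<Delta>_def)
  have sym: "inv_into (carrier \<Gamma>) (\<lambda>x. [x]) \<in> iso \<Delta> \<Gamma>"
    using \<Gamma>.iso_set_sym[OF iso] .
  have "\<not> trivial_group \<Delta>"
    using assms(2,3) \<Delta> iso isomorphic_group_triviality is_isoI by blast
  then have "gainable \<Delta> G B"
    using assms(1) \<Delta> by (auto simp: regular_def)
  then show ?thesis
    by (rule gainable_iso[OF \<Delta> assms(2) sym])
qed

end

theory Submission
  imports Defs
begin

text \<open>Combine a gaining over \<open>\<int>\<^sub>2\<close> and one over \<open>\<int>\<^sub>3\<close> with the same balanced cycles into a gaining
  modulo 6: as each cycle is balanced in both or in neither, its gain is \<open>0\<close> or \<open>\<plusminus>1\<close> modulo 6.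
  After switching, the edges of gain 0 connect the ends of every edge. Every other edge then closes
  up to a cycle through zero edges, so that its gain is \<open>\<plusminus>1\<close> modulo 6 and lifts to the integer \<open>\<plusminus>1\<close>.
  The crucial claim is that all cycles have integer gain \<open>0\<close> or \<open>\<plusminus>1\<close>: a cycle with at least two
  nonzero edges has a chord path of zero edges that splits it into two cycles with fewer nonzero
  edges each; by induction its gain is at most 2 in absolute value, and being \<open>0\<close> or \<open>\<plusminus>1\<close> modulo 6
  it is at most 1. For an element \<open>g \<noteq> 1\<close> of any group, the gains \<open>g\<close> to the power of the
  integer gains therefore have the same balanced cycles.\<close>

subsection \<open>Walks and closed paths\<close>

abbreviation arc_tail :: "'e \<times> 'v \<times> 'v \<Rightarrow> 'v" where
  "arc_tail a \<equiv> fst (snd a)"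

abbreviation arc_head :: "'e \<times> 'v \<times> 'v \<Rightarrow> 'v" where
  "arc_head a \<equiv> snd (snd a)"

text \<open>Among the arcs of a graph, exactly those of loops are fixed. As the gain of a loop is
  unrestricted, antisymmetry is demanded only under \<open>arc_rev a \<noteq> a\<close>.\<close>

definition arc_rev :: "'e \<times> 'v \<times> 'v \<Rightarrow> 'e \<times> 'v \<times> 'v" where
  "arc_rev a = (fst a, arc_head a, arc_tail a)"

definition walk_rev :: "('e \<times> 'v \<times> 'v) list \<Rightarrow> ('e \<times> 'v \<times> 'v) list" where
  "walk_rev p = rev (map arc_rev p)"

lemma arc_rev_simps [simp]:
  "fst (arc_rev a) = fst a" "arc_tail (arc_rev a) = arc_head a" "arc_head (arc_rev a) = arc_tail a"
  "arc_rev (e, x, y) = (e, y, x)" "arc_rev (arc_rev a) = a"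
  by (auto simp: arc_rev_def)

lemma walk_edges_conv: "walk_edges p = map fst p"
  by (auto simp: walk_edges_def)

lemma arc_rev_in_arcs: "a \<in> arcs G \<Longrightarrow> arc_rev a \<in> arcs G"
  by (auto simp: arcs_def)

text \<open>Both sides list the visited vertices in order. On a closed walk, tails and heads thus
  agree up to a cyclic shift.\<close>

lemma walk_tails: "walk G u p w \<Longrightarrow> map arc_tail p @ [w] = u # map arc_head p"
  by (induction G u p w rule: walk.induct) auto

lemma closed_walk_count_tails:
  assumes "walk G u p u"
  shows "count_list (map arc_tail p) v = count_list (map arc_head p) v"
proof -
  have "count_list (map arc_tail p @ [u]) v = count_list (u # map arc_head p) v"
    using walk_tails[OF assms] by simp
  then show ?thesis by (simp split: if_splits)
qed

lemma sum_list_map_eq_0: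
  fixes f :: "'a \<Rightarrow> 'b::monoid_add"
  shows "(\<And>x. x \<in> set xs \<Longrightarrow> f x = 0) \<Longrightarrow> sum_list (map f xs) = 0"
  by (induction xs) auto

lemma distinct_count_list: "distinct xs \<longleftrightarrow> (\<forall>x \<in> set xs. count_list xs x = 1)"
proof (induction xs)
  case (Cons y xs)
  then show ?case
    by (auto simp: count_list_0_iff split: if_splits)
qed auto

text \<open>The representative in \<open>{-1, 0, 1}\<close>; meaningful only for residues \<open>0, 1, 5\<close> modulo 6.\<close>

definition residue6 :: "int \<Rightarrow> int" where
  "residue6 x = (if x mod 6 = 0 then 0 else if x mod 6 = 1 then 1 else - 1)"

lemma residue6_neg: "x mod 6 \<in> {0, 1, 5} \<Longrightarrow> 6 dvd x + y \<Longrightarrow> residue6 y = - residue6 x"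
  unfolding residue6_def insert_iff empty_iff by presburger

text \<open>Modulo 2 the combination is \<open>x\<close>, modulo 3 it is \<open>y\<close>. If both
  vanish it is 0 modulo 6; if neither does it is a unit modulo 6, that is 1 or 5.\<close>

lemma mod_6_of_parity: "(2 dvd x \<longleftrightarrow> 3 dvd y) \<Longrightarrow> (3 * x - 2 * y) mod 6 \<in> {0, 1, 5}" for x y :: int
  unfolding insert_iff empty_iff by presburger

lemma abs_le_1_of_mod_6: "\<bar>x\<bar> \<le> 2 \<Longrightarrow> x mod 6 \<in> {0, 1, 5} \<Longrightarrow> \<bar>x\<bar> \<le> 1" for x :: int
  unfolding insert_iff empty_iff by presburger

lemma eq_0_of_mod_6: "\<bar>x\<bar> \<le> 1 \<Longrightarrow> x mod 6 = y mod 6 \<Longrightarrow> x = 0 \<longleftrightarrow> 2 dvd y" for x y :: int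
  by presburger

context multigraph
begin

lemma arc_ends: "(e, x, y) \<in> arcs G \<Longrightarrow> ends G e = {x, y}"
  using card_ends[of e] by (auto simp: arcs_def loop_def card_1_singleton_iff card_2_iff)

lemma arc_verts: "(e, x, y) \<in> arcs G \<Longrightarrow> x \<in> verts G \<and> y \<in> verts G"
  using ends_subset[of e] by (auto simp: arcs_def)

lemma same_edge_arcs:
  assumes "a \<in> arcs G" "a' \<in> arcs G" "fst a = fst a'"
  shows "a' = a \<or> a' = arc_rev a"
  using assms arc_ends[of "fst a" "arc_tail a" "arc_head a"]
    arc_ends[of "fst a'" "arc_tail a'" "arc_head a'"]
  by (cases a; cases a') (auto simp: arc_rev_def doubleton_eq_iff)

lemma walk_start: "walk G u p w \<Longrightarrow> u \<in> verts G"
  by (cases p) (auto dest: arc_verts)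

lemma walk_append: "walk G u (p @ q) w \<longleftrightarrow> (\<exists>v. walk G u p v \<and> walk G v q w)"
  by (induction p arbitrary: u) (auto dest: walk_start)


lemma walk_split_vertex:
  assumes "walk G u p w" "x \<in> set (u # map arc_head p)"
  obtains p1 p2 where "p = p1 @ p2" "walk G u p1 x" "walk G x p2 w"
proof (cases "x = u")
  case True
  then show ?thesis
    using that[of "[]" p] assms(1) walk_start by auto
next
  case False
  then obtain a where "a \<in> set p" and a: "x = arc_head a"
    using assms(2) by auto
  then obtain q r where p: "p = q @ a # r"
    by (meson split_list)
  then have "walk G u ((q @ [a]) @ r) w"
    using assms(1) by simp
  then obtain v where v: "walk G u (q @ [a]) v" "walk G v r w"
    by (auto simp only: walk_append)
  moreover have "v = x"
    using v(1) a by (cases a) (auto simp: walk_append)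
  ultimately show ?thesis
    using that[of "q @ [a]" r] p by auto
qed

lemma walk_rev_walk: "walk G u p w \<Longrightarrow> walk G w (walk_rev p) u"
proof (induction p arbitrary: u)
  case (Cons a p)
  then show ?case
    using arc_rev_in_arcs[of a G]
    by (cases a) (auto simp: walk_rev_def walk_append dest: arc_verts)
qed (auto simp: walk_rev_def)

section \<open>Paths inside walks\<close>

text \<open>Induction along the walk, cutting off the closed initial part whenever the start recurs.
  The length bound lets \<open>shortest_link\<close> replace a shortest walk by a path.\<close>

lemma walk_to_path:
  assumes "walk G u p w"
  obtains q where "walk G u q w" "set q \<subseteq> set p" "length q \<le> length p" "distinct (u # map arc_head q)"
proof -
  have "\<exists>q. walk G u q w \<and> set q \<subseteq> set p \<and> length q \<le> length p \<and> distinct (u # map arc_head q)"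
    using assms
  proof (induction p arbitrary: u)
    case Nil
    then show ?case by (intro exI[of _ "[]"]) auto
  next
    case (Cons a p)
    have a: "arc_tail a = u" "a \<in> arcs G" "walk G (arc_head a) p w"
      using Cons.prems by (cases a; auto)+
    obtain q where q: "walk G (arc_head a) q w" "set q \<subseteq> set p" "length q \<le> length p"
        "distinct (arc_head a # map arc_head q)"
      using Cons.IH[OF a(3)] by blast
    show ?case
    proof (cases "u \<in> set (arc_head a # map arc_head q)")
      case True
      obtain q1 q2 where s: "q = q1 @ q2" "walk G (arc_head a) q1 u" "walk G u q2 w"
        using walk_split_vertex[OF q(1) True] .
      have "u \<notin> set (map arc_head q2)"
        using walk_tails[OF s(2)] q(4) s(1) by (cases q1 rule: rev_cases) auto
      then show ?thesis
        using s q by (intro exI[of _ q2]) auto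
    next
      case False
      then show ?thesis
        using q a by (intro exI[of _ "a # q"], cases a) auto
    qed
  qed
  then show thesis using that by blast
qed

text \<open>A repeated edge would be traversed by the same arc or its reverse, and either would
  revisit the tail of the first occurrence.\<close>

lemma path_distinct_edges:
  "walk G u p w \<Longrightarrow> distinct (u # map arc_head p) \<Longrightarrow> distinct (map fst p)"
proof (induction p arbitrary: u)
  case (Cons a p)
  have a: "arc_tail a = u" "a \<in> arcs G" "walk G (arc_head a) p w"
    using Cons.prems(1) by (cases a; auto)+
  have "fst a' \<noteq> fst a" if "a' \<in> set p" for a'
  proof
    assume "fst a' = fst a"
    moreover have "a' \<in> arcs G"
      using walk_arcs[OF a(3)] that by auto
    ultimately have "a' = a \<or> a' = arc_rev a"
      using same_edge_arcs[OF a(2)] by auto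
    moreover have "arc_tail a' \<in> set (arc_head a # map arc_head p)"
      unfolding walk_tails[OF a(3), symmetric] using that by simp
    moreover have "arc_head a' \<in> set (arc_head a # map arc_head p)"
      using that by simp
    ultimately have "u \<in> set (arc_head a # map arc_head p)"
      using a(1) by (metis arc_rev_simps(3))
    then show False
      using Cons.prems(2) by simp
  qed
  then show ?case
    using Cons a by force
qed auto

text \<open>A shortest walk from \<open>A\<close> to \<open>R\<close> with arcs of \<open>w\<close>
  can be taken to be a path. An arc with tail in \<open>R\<close> could be dropped with everything
  after it, an arc with head in \<open>A\<close> with everything before it; so the path meets
  \<open>A\<close> only at its start and \<open>R\<close> only at its end.\<close>

lemma shortest_link:
  assumes "walk G u w v" "u \<in> A" "v \<in> R"
  obtains s p t where "walk G s p t" "set p \<subseteq> set w" "s \<in> A" "t \<in> R"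
    "distinct (s # map arc_head p)" "\<And>a. a \<in> set p \<Longrightarrow> arc_tail a \<notin> R \<and> arc_head a \<notin> A"
proof -
  define Q where "Q p \<longleftrightarrow> (\<exists>s t. walk G s p t \<and> set p \<subseteq> set w \<and> s \<in> A \<and> t \<in> R)" for p
  have "Q w" using assms by (auto simp: Q_def)
  then obtain p0 where p0: "Q p0" "\<And>q. Q q \<Longrightarrow> length p0 \<le> length q"
    using ex_has_least_nat[of Q w length] by auto
  then obtain s t where st: "walk G s p0 t" "set p0 \<subseteq> set w" "s \<in> A" "t \<in> R"
    by (auto simp: Q_def)
  obtain p where p: "walk G s p t" "set p \<subseteq> set p0" "length p \<le> length p0"
      "distinct (s # map arc_head p)"
    using walk_to_path[OF st(1)] .
  have "arc_tail a \<notin> R \<and> arc_head a \<notin> A" if a: "a \<in> set p" for a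
  proof -
    obtain q r where qr: "p = q @ a # r"
      using a by (meson split_list)
    have "walk G s q (arc_tail a)" "walk G (arc_head a) r t"
      using p(1) unfolding qr by (cases a; auto simp: walk_append)+
    moreover have "set q \<subseteq> set w" "set r \<subseteq> set w"
      using st(2) p(2) qr by auto
    ultimately have "arc_tail a \<in> R \<Longrightarrow> Q q" "arc_head a \<in> A \<Longrightarrow> Q r"
      unfolding Q_def using st(3,4) by blast+
    then show ?thesis
      using p0(2)[of q] p0(2)[of r] p(3) unfolding qr by auto
  qed
  then show thesis
    using that[OF p(1)] p st by blast
qed

section \<open>Closed paths and chord paths\<close>

text \<open>The directed form of a cycle. Only heads are listed because the start recurs at the end;
  distinct edges exclude going back and forth along one edge.\<close>

definition closed_path :: "'v \<Rightarrow> ('e \<times> 'v \<times> 'v) list \<Rightarrow> bool" where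
  "closed_path u p \<longleftrightarrow> walk G u p u \<and> p \<noteq> [] \<and> distinct (map arc_head p) \<and> distinct (map fst p)"

lemma closed_path_arcs: "closed_path u p \<Longrightarrow> set p \<subseteq> arcs G"
  using walk_arcs[of G u p u] by (simp add: closed_path_def)

lemma closed_path_rotate:
  assumes "closed_path u (p @ a # q)"
  shows "closed_path (arc_tail a) (a # q @ p)"
  using assms by (cases a) (auto simp: closed_path_def walk_append)

text \<open>Equivalently, the edges of \<open>G\<close> in \<open>F\<close> contain a spanning tree
  of each component.\<close>

definition spanning :: "'e set \<Rightarrow> bool" where
  "spanning F \<longleftrightarrow> (\<forall>(e, u, v) \<in> arcs G. \<exists>p. walk G u p v \<and> fst ` set p \<subseteq> F)"

text \<open>Here \<open>l\<close> is the chord path through \<open>F\<close>; it joins the two segments into which \<open>a\<close> and \<open>a'\<close>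
  divide the closed path.\<close>

lemma closed_path_split:
  assumes "closed_path x (a # q @ a' # r)"
    and F_span: "spanning F"
    and F: "fst a \<notin> F" "fst a' \<notin> F"
  obtains q1 q2 r1 r2 l s where
    "q = q1 @ q2" "r = r1 @ r2" "fst ` set l \<subseteq> F" "set l \<subseteq> arcs G"
    "closed_path x (a # q1 @ l @ r2)" "closed_path s (q2 @ a' # r1 @ walk_rev l)"
proof -
  \<comment> \<open>\<open>A\<close> and \<open>R\<close> are the vertex sets of the segments from
    the head of \<open>a\<close> to the tail of \<open>a'\<close> and from the head of
    \<open>a'\<close> to the tail of \<open>a\<close>.\<close>
  define A where "A = set (arc_head a # map arc_head q)"
  define R where "R = set (arc_head a' # map arc_head r)"
  have w: "walk G x (a # q @ a' # r) x" and dh: "distinct (map arc_head (a # q @ a' # r))"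
    and de: "distinct (map fst (a # q @ a' # r))"
    using assms(1) by (auto simp: closed_path_def)
  have x: "arc_tail a = x" and wq: "walk G (arc_head a) q (arc_tail a')"
    and wr: "walk G (arc_head a') r x" and arcs: "a \<in> arcs G" "a' \<in> arcs G"
    using w by (cases a; cases a'; auto simp: walk_append)+
  \<comment> \<open>The ends of \<open>a\<close> lie in different segments, so their connection
    through \<open>F\<close> crosses from \<open>A\<close> to \<open>R\<close>.\<close>
  have "arc_rev a \<in> arcs G" using arcs arc_rev_in_arcs by blast
  then obtain w0 where w0: "walk G (arc_head a) w0 x" "fst ` set w0 \<subseteq> F"
    using F_span x by (auto simp: arc_rev_def spanning_def)
  have disj: "A \<inter> R = {}"
    using dh by (auto simp: A_def R_def)
  have "x \<in> R"
    using walk_tails[OF wr] unfolding R_def by (metis in_set_conv_decomp list.simps(15) list.set_map set_append)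
  then obtain s l t where l: "walk G s l t" "set l \<subseteq> set w0" "s \<in> A" "t \<in> R"
      "distinct (s # map arc_head l)" "\<And>a. a \<in> set l \<Longrightarrow> arc_tail a \<notin> R \<and> arc_head a \<notin> A"
    using shortest_link[OF w0(1), of A R] by (auto simp: A_def)
  obtain q1 q2 where q: "q = q1 @ q2" "walk G (arc_head a) q1 s" "walk G s q2 (arc_tail a')"
    using walk_split_vertex[OF wq l(3)[unfolded A_def]] .
  obtain r1 r2 where r: "r = r1 @ r2" "walk G (arc_head a') r1 t" "walk G t r2 x"
    using walk_split_vertex[OF wr l(4)[unfolded R_def]] .
  have lF: "fst ` set l \<subseteq> F" using l(2) w0(2) by blast
  have larcs: "set l \<subseteq> arcs G" using walk_arcs[OF l(1)] .
  have tailsq: "arc_tail b \<in> A \<and> arc_head b \<in> A" if "b \<in> set q" for b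
  proof -
    have "arc_tail b \<in> set (map arc_tail q @ [arc_tail a'])" using that by auto
    then show ?thesis unfolding walk_tails[OF wq] A_def using that by auto
  qed
  have tailsr: "arc_tail b \<in> R \<and> arc_head b \<in> R" if "b \<in> set r" for b
  proof -
    have "arc_tail b \<in> set (map arc_tail r @ [x])" using that by auto
    then show ?thesis unfolding walk_tails[OF wr] R_def using that by auto
  qed
  \<comment> \<open>Edges of \<open>l\<close> lie in \<open>F\<close>, unlike those of
    \<open>a\<close> and \<open>a'\<close>. An edge of \<open>q\<close> has both ends in
    \<open>A\<close> and one of \<open>r\<close> both ends in \<open>R\<close>, whereas no arc of
    \<open>l\<close> ends in \<open>A\<close> or starts in \<open>R\<close>.\<close>
  have edisj: "fst b \<noteq> fst c" if b: "b \<in> set (a # q @ a' # r)" and c: "c \<in> set l" for b c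
  proof
    assume eq: "fst b = fst c"
    have "b \<in> arcs G" "c \<in> arcs G" using walk_arcs[OF w] b larcs c by auto
    then have bc: "c = b \<or> c = arc_rev b" using same_edge_arcs[of b c] eq by auto
    have "fst c \<in> F" using lF c by auto
    then have "b \<in> set q \<or> b \<in> set r" using b F eq by auto
    then show False
      using tailsq[of b] tailsr[of b] l(6)[OF c] bc by auto
  qed
  then have efl: "fst ` set (a # q @ a' # r) \<inter> fst ` set l = {}"
    by blast
  have dl: "distinct (map fst l)"
    using path_distinct_edges[OF l(1,5)] .
  have lt: "map arc_tail l @ [t] = s # map arc_head l"
    using walk_tails[OF l(1)] .
  have dt: "distinct (map arc_tail l @ [t])" using l(5) lt by simp
  have sq2: "s \<notin> set (map arc_head q2)"
    using walk_tails[OF q(2)] dh q(1) by (cases q1 rule: rev_cases) auto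
  have tr2: "t \<notin> set (map arc_head r2)"
    using walk_tails[OF r(2)] dh r(1) by (cases r1 rule: rev_cases) auto
  have lheads: "arc_head c \<in> R \<Longrightarrow> arc_head c = t" if "c \<in> set l" for c
  proof -
    have "arc_head c \<in> set (map arc_tail l @ [t])" using that unfolding lt by auto
    then show "arc_head c \<in> R \<Longrightarrow> arc_head c = t" using l(6) by auto
  qed
  have ltails: "arc_tail c \<in> A \<Longrightarrow> arc_tail c = s" if "c \<in> set l" for c
  proof -
    have "arc_tail c \<in> set (s # map arc_head l)" using that unfolding lt[symmetric] by auto
    then show "arc_tail c \<in> A \<Longrightarrow> arc_tail c = s" using l(6) by auto
  qed
  have h: "set (map arc_head (a # q1)) \<subseteq> A" "set (map arc_head q2) \<subseteq> A - {s}"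
      "set (map arc_head (a' # r1)) \<subseteq> R" "set (map arc_head r2) \<subseteq> R - {t}"
    using q(1) r(1) sq2 tr2 by (auto simp: A_def R_def)
  have hl: "set (map arc_head l) \<inter> A = {}" "set (map arc_head l) \<inter> R \<subseteq> {t}"
      "set (map arc_tail l) \<inter> R = {}" "set (map arc_tail l) \<inter> A \<subseteq> {s}"
    using l(6) lheads ltails by auto
  have "walk G x (a # q1 @ l @ r2) x"
    using x arcs q(2) l(1) r(3) by (cases a) (auto simp: walk_append)
  moreover have "distinct (map arc_head (a # q1 @ l @ r2))"
  proof -
    have "distinct (map arc_head (a # q1))" "distinct (map arc_head r2)" "distinct (map arc_head l)"
      using dh q(1) r(1) l(5) by auto
    moreover have "set (map arc_head (a # q1)) \<inter> set (map arc_head l) = {}"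
      using h(1) hl(1) by blast
    moreover have "set (map arc_head (a # q1)) \<inter> set (map arc_head r2) = {}"
      using h(1,4) disj by blast
    moreover have "set (map arc_head l) \<inter> set (map arc_head r2) = {}"
      using h(4) hl(2) by blast
    ultimately show ?thesis by auto
  qed
  moreover have "distinct (map fst (a # q1 @ l @ r2))"
  proof -
    have "distinct (map fst (a # q1))" "distinct (map fst r2)"
      "set (map fst (a # q1)) \<inter> set (map fst r2) = {}"
      using de q(1) r(1) by auto
    moreover have "set (map fst (a # q1)) \<inter> set (map fst l) = {}"
      "set (map fst r2) \<inter> set (map fst l) = {}"
      using efl q(1) r(1) by (auto simp: image_Un)
    ultimately show ?thesis using dl by auto
  qed
  ultimately have c1: "closed_path x (a # q1 @ l @ r2)"
    by (simp add: closed_path_def)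
  have "walk G s (q2 @ a' # r1 @ walk_rev l) s"
    using arcs q(3) walk_rev_walk[OF l(1)] r(2) by (cases a') (auto simp: walk_append)
  \<comment> \<open>The heads of the reversed chord are the tails of \<open>l\<close>: they include
    \<open>s\<close> but not \<open>t\<close>, which has already been reached before the
    chord.\<close>
  moreover have "map arc_head (walk_rev l) = rev (map arc_tail l)"
    "map fst (walk_rev l) = rev (map fst l)"
    by (auto simp: walk_rev_def rev_map)
  moreover have "distinct (map arc_head (q2 @ a' # r1) @ rev (map arc_tail l))"
  proof -
    have "distinct (map arc_head (q2 @ a' # r1))"
      using dh q(1) r(1) by auto
    moreover have "set (map arc_head q2) \<inter> set (map arc_tail l) = {}"
      using h(2) hl(4) by blast
    moreover have "set (map arc_head (a' # r1)) \<inter> set (map arc_tail l) = {}"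
      using h(3) hl(3) by blast
    ultimately show ?thesis using dt by auto
  qed
  moreover have "distinct (map fst (q2 @ a' # r1) @ rev (map fst l))"
  proof -
    have "distinct (map fst (q2 @ a' # r1))" using de q(1) r(1) by auto
    moreover have "set (map fst (q2 @ a' # r1)) \<inter> set (map fst l) = {}"
      using efl q(1) r(1) by (auto simp: image_Un)
    ultimately show ?thesis using dl by auto
  qed
  ultimately have c2: "closed_path s (q2 @ a' # r1 @ walk_rev l)"
    by (simp add: closed_path_def)
  show thesis
    using that[OF q(1) r(1) lF larcs c1 c2] .
qed

lemma closed_path_sum_le_1:
  fixes b :: "'e \<times> 'v \<times> 'v \<Rightarrow> int"
  assumes F_span: "spanning F"
    and zero: "\<And>a. a \<in> arcs G \<Longrightarrow> fst a \<in> F \<Longrightarrow> b a = 0"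
    and le: "\<And>a. a \<in> arcs G \<Longrightarrow> \<bar>b a\<bar> \<le> 1"
    and mod6: "\<And>u p. closed_path u p \<Longrightarrow> sum_list (map b p) mod 6 \<in> {0, 1, 5}"
    and "closed_path u p"
  shows "\<bar>sum_list (map b p)\<bar> \<le> 1"
  using \<open>closed_path u p\<close>
proof (induction "length (filter (\<lambda>a. fst a \<notin> F) p)" arbitrary: u p rule: less_induct)
  case less
  define N where "N p = filter (\<lambda>a. fst a \<notin> F) p" for p :: "('e \<times> 'v \<times> 'v) list"
  have arcs: "set p \<subseteq> arcs G"
    using closed_path_arcs[OF less.prems] .
  have sumN: "sum_list (map b p) = sum_list (map b (N p))"
    unfolding N_def using arcs zero by (intro sum_list_map_filter[symmetric]) auto
  show ?case
  proof (cases "N p")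
    case Nil
    then show ?thesis using sumN by simp
  next
    case (Cons a as)
    then have "a \<in> set (N p)" by simp
    then have a: "a \<in> set p" "fst a \<notin> F"
      by (auto simp: N_def)
    then obtain p1 p2 where p: "p = p1 @ a # p2"
      by (meson split_list)
    \<comment> \<open>Rotation puts \<open>a\<close> first; neither the sum nor the number of arcs
      outside \<open>F\<close> changes.\<close>
    have rot: "closed_path (arc_tail a) (a # p2 @ p1)"
      using less.prems closed_path_rotate p by blast
    show ?thesis
    proof (cases "N (p2 @ p1)")
      case Nil
      then have "N p = [a]"
        using a(2) p by (auto simp: N_def)
      then show ?thesis using sumN le[of a] a(1) arcs by auto
    next
      case (Cons a' as')
      then have "a' \<in> set (N (p2 @ p1))" by simp
      then have a': "a' \<in> set (p2 @ p1)" "fst a' \<notin> F"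
        by (auto simp: N_def)
      then obtain q r where qr: "p2 @ p1 = q @ a' # r"
        by (meson split_list)
      obtain q1 q2 r1 r2 l s where split: "q = q1 @ q2" "r = r1 @ r2" "fst ` set l \<subseteq> F" "set l \<subseteq> arcs G"
        "closed_path (arc_tail a) (a # q1 @ l @ r2)" "closed_path s (q2 @ a' # r1 @ walk_rev l)"
        using closed_path_split[OF rot[unfolded qr] F_span a(2) a'(2)] .
      have len: "length (N p) = length (N (a # q @ a' # r))"
        using arg_cong[OF qr, of "\<lambda>x. length (N x)"] p by (simp add: N_def)
      have sum: "sum_list (map b p) = sum_list (map b (a # q @ a' # r))"
        using arg_cong[OF qr, of "\<lambda>x. sum_list (map b x)"] p by simp
      have Nl: "N l = []" "N (walk_rev l) = []"
        using split(3) by (auto simp: N_def filter_empty_conv walk_rev_def)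
      \<comment> \<open>\<open>zero\<close> covers both directions of an edge in \<open>F\<close>,
        so the chord contributes nothing to either closed path.\<close>
      have "sum_list (map b l) = 0"
        by (rule sum_list_map_eq_0) (use split(3,4) zero in blast)
      moreover have "b (arc_rev c) = 0" if "c \<in> set l" for c
        using that split(3,4) zero[of "arc_rev c"] arc_rev_in_arcs[of c G] by auto
      then have "sum_list (map b (walk_rev l)) = 0"
        by (intro sum_list_map_eq_0) (auto simp: walk_rev_def)
      ultimately have sum2: "sum_list (map b p) = sum_list (map b (a # q1 @ l @ r2)) +
          sum_list (map b (q2 @ a' # r1 @ walk_rev l))"
        using sum split(1,2) by simp
      \<comment> \<open>Each part contains only one of \<open>a\<close> and \<open>a'\<close>, and
        the chord adds no arc outside \<open>F\<close>.\<close>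
      have "length (N (a # q1 @ l @ r2)) < length (N p)"
        "length (N (q2 @ a' # r1 @ walk_rev l)) < length (N p)"
        using len Nl split(1,2) a(2) a'(2) by (auto simp: N_def)
      then have "\<bar>sum_list (map b (a # q1 @ l @ r2))\<bar> \<le> 1"
        "\<bar>sum_list (map b (q2 @ a' # r1 @ walk_rev l))\<bar> \<le> 1"
        using less.hyps split(5,6) unfolding N_def by blast+
      then have "\<bar>sum_list (map b p)\<bar> \<le> 2"
        using sum2 by linarith
      moreover have "sum_list (map b p) mod 6 \<in> {0, 1, 5}"
        using mod6[OF less.prems] .
      ultimately show ?thesis
        by (rule abs_le_1_of_mod_6)
    qed
  qed
qed

text \<open>A return path through \<open>F\<close> cannot use the edge of \<open>a\<close>, so it
  closes \<open>a\<close> up to a fundamental cycle. For a loop this path is empty.\<close>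

lemma arc_in_closed_path:
  assumes F_span: "spanning F"
    and a: "a \<in> arcs G" "fst a \<notin> F"
  obtains p where "closed_path (arc_tail a) (a # p)" "fst ` set p \<subseteq> F"
proof -
  obtain w where w: "walk G (arc_head a) w (arc_tail a)" "fst ` set w \<subseteq> F"
    using F_span arc_rev_in_arcs[OF a(1)] by (auto simp: arc_rev_def spanning_def)
  obtain p where p: "walk G (arc_head a) p (arc_tail a)" "set p \<subseteq> set w"
      "distinct (arc_head a # map arc_head p)"
    using walk_to_path[OF w(1)] by blast
  have pF: "fst ` set p \<subseteq> F"
    using p(2) w(2) by blast
  have "walk G (arc_tail a) (a # p) (arc_tail a)"
    using p(1) a(1) by (cases a) auto
  moreover have "distinct (map fst (a # p))"
    using path_distinct_edges[OF p(1,3)] pF a(2) by auto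
  ultimately show thesis
    using that[OF _ pF] p(3) by (simp add: closed_path_def)
qed

section \<open>Switching by a potential\<close>

text \<open>\<open>\<phi>\<close> is a switching function: it changes the gains of arcs but
  telescopes away on closed walks. Choosing it to make as many edges as possible zero modulo
  \<open>m\<close> replaces the construction of a spanning forest.\<close>

lemma spanning_zero_potential:
  fixes f :: "'e \<times> 'v \<times> 'v \<Rightarrow> int" and m :: int
  assumes anti: "\<And>a. a \<in> arcs G \<Longrightarrow> arc_rev a \<noteq> a \<Longrightarrow> m dvd f a + f (arc_rev a)"
  obtains \<phi> F where "spanning F"
    "\<forall>a \<in> arcs G. fst a \<in> F \<longrightarrow> m dvd \<phi> (arc_tail a) + f a - \<phi> (arc_head a)"
proof -
  define c where "c \<phi> a = \<phi> (arc_tail a) + f a - \<phi> (arc_head a)" for \<phi> a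
  define F where "F \<phi> = {e \<in> edges G. \<forall>a \<in> arcs G. fst a = e \<longrightarrow> m dvd c \<phi> a}" for \<phi>
  have fin: "finite (F \<phi>)" and "card (F \<phi>) \<le> card (edges G)" for \<phi>
    using finite_edges by (auto simp: F_def intro: card_mono)
  \<comment> \<open>If \<open>F \<phi>\<close> did not connect the ends of \<open>e\<close>, then shifting \<open>\<phi>\<close> on a component of \<open>F \<phi>\<close> would
    make \<open>e\<close> zero as well.\<close>
  then obtain \<phi> where max: "\<And>\<psi>. card (F \<psi>) \<le> card (F \<phi>)"
    using ex_has_greatest_nat[of "\<lambda>_. True" _ "\<lambda>\<phi>. card (F \<phi>)" "Suc (card (edges G))"] by (auto simp: less_Suc_eq_le)
  have conn: "\<exists>p. walk G u p v \<and> fst ` set p \<subseteq> F \<phi>" if e: "(e, u, v) \<in> arcs G" for e u v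
  proof (rule ccontr)
    assume no: "\<not> ?thesis"
    define S where "S = {x. \<exists>p. walk G u p x \<and> fst ` set p \<subseteq> F \<phi>}"
    \<comment> \<open>\<open>S\<close> is the component of \<open>u\<close> in
      \<open>F \<phi>\<close>. Subtracting the gain of \<open>(e, u, v)\<close> on \<open>S\<close>
      makes this arc zero, as \<open>v\<close> lies outside \<open>S\<close>.\<close>
    define \<psi> where "\<psi> x = \<phi> x - (if x \<in> S then c \<phi> (e, u, v) else 0)" for x
    have "walk G u [] u" "walk G u [(e, u, v)] v"
      using e arc_verts by auto
    moreover have "fst ` set [] \<subseteq> F \<phi>" by simp
    ultimately have u: "u \<in> S"
      unfolding S_def by blast
    have v: "v \<notin> S" using no by (simp add: S_def)
    have eF: "e \<notin> F \<phi>"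
    proof
      assume "e \<in> F \<phi>"
      then have "fst ` set [(e, u, v)] \<subseteq> F \<phi>" by simp
      then show False using no \<open>walk G u [(e, u, v)] v\<close> by blast
    qed
    have step: "arc_head a \<in> S" if a: "a \<in> arcs G" "fst a \<in> F \<phi>" "arc_tail a \<in> S" for a
    proof -
      obtain p where "walk G u p (arc_tail a)" "fst ` set p \<subseteq> F \<phi>"
        using a(3) by (auto simp: S_def)
      then have "walk G u (p @ [a]) (arc_head a)" "fst ` set (p @ [a]) \<subseteq> F \<phi>"
        using a arc_verts by (cases a; auto simp: walk_append)+
      then show ?thesis unfolding S_def by blast
    qed
    have "m dvd c \<psi> a" if "a \<in> arcs G" "fst a \<in> F \<phi>" for a
    proof -
      \<comment> \<open>Edges of \<open>F \<phi>\<close> do not leave \<open>S\<close>, so the shift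
        acts on both ends or on neither.\<close>
      have "arc_tail a \<in> S \<longleftrightarrow> arc_head a \<in> S"
        using step[of a] step[of "arc_rev a"] that arc_rev_in_arcs[of a G] by auto
      then have "c \<psi> a = c \<phi> a" by (auto simp: c_def \<psi>_def)
      then show ?thesis using that by (auto simp: F_def)
    qed
    moreover have "m dvd c \<psi> a" if a: "a \<in> arcs G" "fst a = e" for a
    proof -
      consider "a = (e, u, v)" | "a = (e, v, u)"
        using same_edge_arcs[OF e a(1)] a(2) by auto
      then show ?thesis
      proof cases
        case 1
        then show ?thesis using u v by (simp add: c_def \<psi>_def)
      next
        case 2
        \<comment> \<open>The switched gain of the reverse arc is
          \<open>f (e, u, v) + f (e, v, u)\<close>; \<open>e\<close> is not a loop because
          \<open>S\<close> separates its ends.\<close>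
        then show ?thesis using anti[OF e] u v by (auto simp: c_def \<psi>_def add.commute)
      qed
    qed
    moreover have "e \<in> edges G" using e by (auto simp: arcs_def)
    ultimately have "insert e (F \<phi>) \<subseteq> F \<psi>"
      by (auto simp: F_def)
    then have "card (insert e (F \<phi>)) \<le> card (F \<psi>)"
      using fin card_mono by blast
    then show False
      using max[of \<psi>] eF fin by simp
  qed
  show thesis
    by (rule that[of "F \<phi>" \<phi>]) (use conn in \<open>auto simp: spanning_def F_def c_def\<close>)
qed

subsection \<open>Cycles and closed paths\<close>

text \<open>Each arc adds one tail and one head. For a loop both fall on the same vertex, matching
  the second cardinality.\<close>

lemma degree_count:
  assumes "set p \<subseteq> arcs G" "distinct (map fst p)"
  shows "card {e \<in> fst ` set p. v \<in> ends G e} + card {e \<in> fst ` set p. card (ends G e) = 1 \<and> v \<in> ends G e} =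
    count_list (map arc_tail p) v + count_list (map arc_head p) v"
  using assms
proof (induction p)
  case (Cons a p)
  have ends: "ends G (fst a) = {arc_tail a, arc_head a}"
    using Cons.prems(1) arc_ends[of "fst a" "arc_tail a" "arc_head a"] by simp
  have ins: "card {e \<in> fst ` set (a # p). P e} = card {e \<in> fst ` set p. P e} + (if P (fst a) then 1 else 0)" for P
  proof -
    have "{e \<in> fst ` set (a # p). P e} = (if P (fst a) then insert (fst a) {e \<in> fst ` set p. P e} else {e \<in> fst ` set p. P e})"
      by auto
    then show ?thesis using Cons.prems(2) by auto
  qed
  show ?case
    unfolding ins ends using Cons by (auto simp: card_1_singleton_iff doubleton_eq_iff)
qed auto

text \<open>Heads suffice as vertices, since on a closed walk every tail is also a head. The
  incidence map stays that of \<open>G\<close>, as \<open>subgraph\<close> requires.\<close>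

definition walk_graph :: "('e \<times> 'v \<times> 'v) list \<Rightarrow> ('v, 'e) graph" where
  "walk_graph p = \<lparr>verts = arc_head ` set p, edges = fst ` set p, ends = ends G\<rparr>"

lemma walk_in_subgraph:
  assumes "subgraph C G" "walk G u p w" "fst ` set p \<subseteq> edges C" "u \<in> verts C"
  shows "walk C u p w"
  using assms(2-4)
proof (induction p arbitrary: u)
  case (Cons a p)
  interpret C: multigraph C using assms(1) by (simp add: subgraph_def)
  have "a \<in> arcs C"
    using Cons.prems(1,2) assms(1) by (cases a) (auto simp: arcs_def subgraph_def loop_def)
  then show ?case
    using Cons C.arc_verts by (cases a) auto
qed auto

lemma walk_from_subgraph:
  assumes "subgraph C G"
  shows "walk C u p w \<Longrightarrow> walk G u p w"
proof (induction p arbitrary: u)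
  case Nil
  then show ?case using assms by (auto simp: subgraph_def)
next
  case (Cons a p)
  then show ?case using subgraph_arcs[OF assms] by (cases a) auto
qed

lemma set_tails:
  assumes "closed_path u p"
  shows "arc_tail ` set p = arc_head ` set p"
proof -
  have "x \<in> set (map arc_tail p) \<longleftrightarrow> x \<in> set (map arc_head p)" for x
    using closed_walk_count_tails[of G u p x] assms
    by (metis closed_path_def count_list_0_iff)
  then show ?thesis by auto
qed

lemma distinct_tails:
  assumes "closed_path u p"
  shows "distinct (map arc_tail p)"
proof -
  have "count_list (map arc_tail p) x = 1" if "x \<in> arc_tail ` set p" for x
    using assms that set_tails[OF assms] closed_walk_count_tails[of G u p x]
    unfolding closed_path_def distinct_count_list by (metis image_set)
  then show ?thesis by (auto simp: distinct_count_list)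
qed

text \<open>Each vertex is the head of exactly one arc and the tail of exactly one, so
  \<open>degree_count\<close> gives degree 2, also for a loop.\<close>

lemma closed_path_cycle:
  assumes p: "closed_path u p"
  shows "cycle G (walk_graph p)" "simple_closed_walk (walk_graph p) u p"
proof -
  let ?C = "walk_graph p"
  have w: "walk G u p u" and ne: "p \<noteq> []" and dh: "distinct (map arc_head p)"
    and de: "distinct (map fst p)"
    using p by (auto simp: closed_path_def)
  have arcs: "set p \<subseteq> arcs G" using walk_arcs[OF w] .
  have u: "u \<in> verts ?C"
    using walk_tails[OF w] ne set_tails[OF p] by (cases p) (auto simp: walk_graph_def)
  have "ends G (fst a) \<subseteq> verts ?C" if "a \<in> set p" for a
  proof -
    have "ends G (fst a) = {arc_tail a, arc_head a}"
      using arc_ends[of "fst a" "arc_tail a" "arc_head a"] arcs that by auto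
    moreover have "arc_tail a \<in> arc_head ` set p"
      using that set_tails[OF p] by blast
    ultimately show ?thesis using that by (simp add: walk_graph_def)
  qed
  then have "multigraph ?C"
    using arcs card_ends unfolding multigraph_def walk_graph_def by (fastforce simp: arcs_def)
  have sub: "subgraph ?C G"
  proof -
    have "fst a \<in> edges G" "arc_head a \<in> verts G" if "a \<in> set p" for a
      using arcs that arc_verts[of "fst a" "arc_tail a" "arc_head a"] by (auto simp: arcs_def)
    then show ?thesis
      using \<open>multigraph ?C\<close> by (auto simp: subgraph_def walk_graph_def)
  qed
  interpret C: multigraph ?C by fact
  have wC: "walk ?C u p u"
    using walk_in_subgraph[OF sub w _ u] by (simp add: walk_graph_def)
  have "\<exists>q. walk ?C x q y" if "x \<in> verts ?C" "y \<in> verts ?C" for x y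
  proof -
    have "x \<in> set (u # map arc_head p)" "y \<in> set (u # map arc_head p)"
      using that by (auto simp: walk_graph_def)
    then obtain q1 q2 where "walk ?C u q1 y" "walk ?C x q2 u"
      using C.walk_split_vertex[OF wC] by metis
    then show ?thesis
      using C.walk_append by blast
  qed
  moreover have "degree ?C v = 2" if "v \<in> verts ?C" for v
  proof -
    have "degree ?C v = card {e \<in> fst ` set p. v \<in> ends G e} +
        card {e \<in> fst ` set p. card (ends G e) = 1 \<and> v \<in> ends G e}"
      by (simp add: degree_def walk_graph_def loop_def conj_assoc)
    also have "\<dots> = 2 * count_list (map arc_head p) v"
      using degree_count[OF arcs de] closed_walk_count_tails[OF w] by simp
    also have "count_list (map arc_head p) v = 1"
      using dh that by (auto simp: distinct_count_list walk_graph_def)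
    finally show ?thesis by simp
  qed
  ultimately show "cycle G ?C"
    using sub u by (auto simp: cycle_def connected_graph_def)
  show "simple_closed_walk ?C u p"
    using wC de by (auto simp: simple_closed_walk_def walk_edges_conv walk_graph_def)
qed

text \<open>As every edge is used once, the degree 2 is twice the number of visits, so each vertex
  is visited exactly once. Counting visits to \<open>u\<close> also rules out the empty
  walk.\<close>

lemma simple_closed_walk_closed_path:
  assumes C: "cycle G C" and p: "simple_closed_walk C u p"
  shows "closed_path u p"
proof -
  have sub: "subgraph C G" and deg: "\<And>v. v \<in> verts C \<Longrightarrow> degree C v = 2"
    using C by (auto simp: cycle_def)
  interpret C: multigraph C using sub by (simp add: subgraph_def)
  have wC: "walk C u p u" and de: "distinct (map fst p)" and E: "edges C = fst ` set p"
    using p by (auto simp: simple_closed_walk_def walk_edges_conv)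
  have w: "walk G u p u" using walk_from_subgraph[OF sub wC] .
  have count: "count_list (map arc_head p) v = 1" if "v \<in> verts C" for v
  proof -
    have "degree C v = card {e \<in> fst ` set p. v \<in> ends C e} +
        card {e \<in> fst ` set p. card (ends C e) = 1 \<and> v \<in> ends C e}"
      by (simp add: degree_def E loop_def conj_assoc)
    also have "\<dots> = 2 * count_list (map arc_head p) v"
      using C.degree_count[OF walk_arcs[OF wC] de] closed_walk_count_tails[OF wC] by simp
    finally show ?thesis using deg[OF that] by simp
  qed
  have "arc_head a \<in> verts C" if "a \<in> set p" for a
    using walk_arcs[OF wC] that C.arc_verts[of "fst a" "arc_tail a" "arc_head a"] by auto
  then have "distinct (map arc_head p)"
    using count by (auto simp: distinct_count_list)
  moreover have "p \<noteq> []"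
    using count[of u] C.walk_start[OF wC] by auto
  ultimately show ?thesis
    using w de by (simp add: closed_path_def)
qed

text \<open>Only two of the edges of \<open>p\<close> meet any vertex, so that \<open>q\<close> has to follow \<open>p\<close> once the two
  share an arc.\<close>

lemma closed_path_same_edges:
  assumes p: "closed_path u p" and q: "closed_path v q" and E: "fst ` set p = fst ` set q"
    and a: "a \<in> set p" "a \<in> set q"
  shows "set p \<subseteq> set q"
proof -
  have arcs: "set p \<subseteq> arcs G" "set q \<subseteq> arcs G"
    using closed_path_arcs[OF p] closed_path_arcs[OF q] .
  have inj: "inj_on arc_tail (set p)" "inj_on arc_head (set p)" "inj_on fst (set q)"
    using distinct_tails[OF p] p q by (auto simp: closed_path_def distinct_map)
  have succ: "d \<in> set q" if c: "c \<in> set q" "c \<in> set p" and d: "d \<in> set p" "arc_tail d = arc_head c" for c d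
  proof -
    obtain c' where c': "c' \<in> set q" "arc_tail c' = arc_head c"
      using set_tails[OF q] c(1) by (metis imageE imageI)
    obtain c'' where c'': "c'' \<in> set p" "fst c'' = fst c'"
      using E c'(1) by (metis imageE imageI)
    then consider "c' = c''" | "c' = arc_rev c''"
      using same_edge_arcs[of c'' c'] arcs c'(1) by auto
    then have "c' \<in> set p"
    proof cases
      \<comment> \<open>Here \<open>c''\<close> enters the head of \<open>c\<close>, as
        \<open>c\<close> itself does, and so is \<open>c\<close>; then \<open>c'\<close> and
        \<open>c\<close> use the same edge in \<open>q\<close> and coincide.\<close>
      case 2
      then have "c'' = c"
        using inj_onD[OF inj(2), of c'' c] c'(2) c''(1) c(2) by simp
      then show ?thesis
        using inj(3) c'(1) c''(2) c by (metis inj_onD)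
    qed (use c''(1) in simp)
    then have "c' = d"
      using inj_onD[OF inj(1)] c'(2) d by metis
    then show ?thesis using c'(1) by simp
  qed
  have follow: "set r \<subseteq> set q"
    if "walk G (arc_head c) r w" "set r \<subseteq> set p" "c \<in> set q" "c \<in> set p" for c r w
    using that
  proof (induction r arbitrary: c)
    case (Cons d r)
    have d: "arc_tail d = arc_head c" "walk G (arc_head d) r w" "d \<in> set p" "set r \<subseteq> set p"
      using Cons.prems(1,2) by (cases d; auto)+
    then have "d \<in> set q"
      using succ[OF Cons.prems(3,4)] by blast
    then show ?case
      using Cons.IH[OF d(2,4)] d(3) by simp
  qed auto
  obtain p1 p2 where split: "p = p1 @ a # p2"
    using a(1) by (meson split_list)
  then have "closed_path (arc_tail a) (a # p2 @ p1)"
    using closed_path_rotate p by blast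
  then have "walk G (arc_head a) (p2 @ p1) (arc_tail a)"
    by (cases a) (auto simp: closed_path_def)
  then have "set (p2 @ p1) \<subseteq> set q"
    using follow[of a "p2 @ p1"] a split by auto
  then show ?thesis
    using a split by auto
qed

text \<open>Closed paths with the same edges that share an arc have the same arcs. Otherwise one
  consists of the reverses of the other's arcs, and the two sums add up to a multiple of
  \<open>m\<close>.\<close>

lemma dvd_sum_closed_path:
  fixes f :: "'e \<times> 'v \<times> 'v \<Rightarrow> int"
  assumes anti: "\<And>a. a \<in> arcs G \<Longrightarrow> arc_rev a \<noteq> a \<Longrightarrow> m dvd f a + f (arc_rev a)"
    and p: "closed_path u p" and q: "closed_path v q" and E: "fst ` set p = fst ` set q"
  shows "m dvd sum_list (map f p) \<longleftrightarrow> m dvd sum_list (map f q)"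
proof -
  have arcs: "set p \<subseteq> arcs G" "set q \<subseteq> arcs G"
    using closed_path_arcs[OF p] closed_path_arcs[OF q] .
  have "distinct p" "distinct q"
    using p q by (auto simp: closed_path_def distinct_map)
  then have sums: "sum_list (map f p) = sum f (set p)" "sum_list (map f q) = sum f (set q)"
    by (simp_all add: sum_list_distinct_conv_sum_set)
  show ?thesis
  proof (cases "set p \<inter> set q = {}")
    case False
    then have "set p = set q"
      using closed_path_same_edges[OF p q E] closed_path_same_edges[OF q p E[symmetric]] by blast
    then show ?thesis using sums by simp
  next
    case True
    \<comment> \<open>Without common arcs, the arc of the other closed path on the same edge is the
      reverse and differs from \<open>c\<close>. So no loop occurs here and \<open>anti\<close>
      applies.\<close>
    have rev: "arc_rev c \<in> set B \<and> arc_rev c \<noteq> c"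
      if A: "set A \<subseteq> arcs G" "set B \<subseteq> arcs G" "set A \<inter> set B = {}" "fst ` set A = fst ` set B" "c \<in> set A"
      for c A B
    proof -
      obtain d where d: "d \<in> set B" "fst d = fst c"
        using A(4,5) by (metis imageE imageI)
      then have "d = c \<or> d = arc_rev c"
        using same_edge_arcs[of c d] A by auto
      then show ?thesis using A d(1) by auto
    qed
    have "arc_rev ` set p = set q"
    proof
      show "arc_rev ` set p \<subseteq> set q"
        using rev[OF arcs True E] by auto
      show "set q \<subseteq> arc_rev ` set p"
        using rev[OF arcs(2,1) _ E[symmetric]] True arc_rev_simps(5)
        by (metis Int_commute imageI subsetI)
    qed
    moreover have "inj_on arc_rev (set p)"
      by (metis arc_rev_simps(5) inj_onI)
    ultimately have "sum f (set q) = (\<Sum>a\<in>set p. f (arc_rev a))"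
      by (metis (no_types, lifting) comp_apply sum.cong sum.reindex)
    then have "sum f (set p) + sum f (set q) = (\<Sum>a\<in>set p. f a + f (arc_rev a))"
      by (simp add: sum.distrib)
    moreover have "m dvd \<dots>"
      using anti rev[OF arcs True E] arcs(1) by (intro dvd_sum) auto
    ultimately show ?thesis
      unfolding sums by (metis dvd_add_right_iff dvd_add_left_iff)
  qed
qed

subsection \<open>Gains\<close>

lemma gain_integer_mod_group:
  assumes "n > 0"
  shows "gain (integer_mod_group n) \<gamma> p = sum_list (map \<gamma> p) mod int n"
  by (induction p) (simp_all add: gain_def mod_add_right_eq)

lemma gaining_integer_mod_group_rev:
  assumes "gaining (integer_mod_group n) G \<gamma>" "a \<in> arcs G" "arc_rev a \<noteq> a"
  shows "int n dvd \<gamma> a + \<gamma> (arc_rev a)"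
proof -
  obtain e u v where a: "a = (e, u, v)" by (cases a)
  have "\<not> loop G e"
    using assms(2,3) arc_ends[of e u v] by (auto simp: a loop_def card_1_singleton_iff doubleton_eq_iff)
  moreover have "\<gamma> (e, u, v) \<in> carrier (integer_mod_group n)"
    using assms(1,2) by (auto simp: a gaining_def)
  ultimately have "\<gamma> (arc_rev a) = (- \<gamma> a) mod int n"
    using assms(1,2) by (auto simp: a gaining_def)
  then show ?thesis
    by (simp add: dvd_eq_mod_eq_0 mod_add_right_eq)
qed

text \<open>All simple closed walks of \<open>walk_graph p\<close> are closed paths with the edges
  of \<open>p\<close>, so testing \<open>p\<close> alone decides balance.\<close>

lemma walk_graph_balanced_iff:
  assumes "n > 0" and \<gamma>: "gaining (integer_mod_group n) G \<gamma>" and p: "closed_path u p"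
  shows "walk_graph p \<in> gain_balanced (integer_mod_group n) G \<gamma> \<longleftrightarrow> int n dvd sum_list (map \<gamma> p)"
proof -
  note C = closed_path_cycle[OF p]
  have "int n dvd sum_list (map \<gamma> q) \<longleftrightarrow> int n dvd sum_list (map \<gamma> p)"
    if q: "simple_closed_walk (walk_graph p) v q" for v q
  proof (rule dvd_sum_closed_path[where f = \<gamma> and m = "int n", OF gaining_integer_mod_group_rev[OF \<gamma>]])
    show "closed_path v q" using simple_closed_walk_closed_path[OF C(1) q] .
    show "fst ` set q = fst ` set p"
      using q by (simp add: simple_closed_walk_def walk_edges_conv walk_graph_def)
  qed (use p in auto)
  then have "walk_graph p \<in> gain_balanced (integer_mod_group n) G \<gamma> \<longleftrightarrow>
      (\<forall>v q. simple_closed_walk (walk_graph p) v q \<longrightarrow> int n dvd sum_list (map \<gamma> p))"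
    using C(1) gain_integer_mod_group[OF \<open>n > 0\<close>, of \<gamma>]
    by (simp add: gain_balanced_def dvd_eq_mod_eq_0)
  then show ?thesis
    using C(2) by blast
qed

lemma sum_potential:
  fixes \<phi> :: "'v \<Rightarrow> int"
  assumes "walk G u p w"
  shows "sum_list (map (\<lambda>a. \<phi> (arc_tail a) + f a - \<phi> (arc_head a)) p) = \<phi> u + sum_list (map f p) - \<phi> w"
  using assms by (induction p arbitrary: u) auto

lemma integer_gaining:
  assumes \<alpha>: "gaining (integer_mod_group 2) G \<alpha>" and \<beta>: "gaining (integer_mod_group 3) G \<beta>"
    and eq: "gain_balanced (integer_mod_group 2) G \<alpha> = gain_balanced (integer_mod_group 3) G \<beta>"
  obtains b :: "'e \<times> 'v \<times> 'v \<Rightarrow> int" where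
    "\<And>a. a \<in> arcs G \<Longrightarrow> arc_rev a \<noteq> a \<Longrightarrow> b (arc_rev a) = - b a"
    "\<And>u p. closed_path u p \<Longrightarrow> \<bar>sum_list (map b p)\<bar> \<le> 1"
    "\<And>u p. closed_path u p \<Longrightarrow> sum_list (map b p) = 0 \<longleftrightarrow> 2 dvd sum_list (map \<alpha> p)"
proof -
  \<comment> \<open>The Chinese remainder combination: \<open>f\<close> agrees with
    \<open>\<alpha>\<close> modulo 2 and with \<open>\<beta>\<close> modulo 3.\<close>
  define f where "f a = 3 * \<alpha> a - 2 * \<beta> a" for a
  have f_rev: "6 dvd f a + f (arc_rev a)" if "a \<in> arcs G" "arc_rev a \<noteq> a" for a
    using gaining_integer_mod_group_rev[OF \<alpha> that] gaining_integer_mod_group_rev[OF \<beta> that]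
    unfolding f_def by simp presburger
  obtain \<phi> F where F_span: "spanning F"
    and "\<forall>a \<in> arcs G. fst a \<in> F \<longrightarrow> 6 dvd \<phi> (arc_tail a) + f a - \<phi> (arc_head a)"
    using spanning_zero_potential[of 6 f] f_rev by metis
  then have zero: "6 dvd \<phi> (arc_tail a) + f a - \<phi> (arc_head a)" if "a \<in> arcs G" "fst a \<in> F" for a
    using that by blast
  define c where "c a = \<phi> (arc_tail a) + f a - \<phi> (arc_head a)" for a
  define b where "b a = residue6 (c a)" for a
  have c_sum: "sum_list (map c p) mod 6 \<in> {0, 1, 5}"
    "2 dvd sum_list (map c p) \<longleftrightarrow> 2 dvd sum_list (map \<alpha> p)" if p: "closed_path u p" for u p
  proof -
    have "sum_list (map c p) = sum_list (map f p)"
      using sum_potential[of u p u \<phi> f, folded c_def] p by (simp add: closed_path_def)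
    also have "\<dots> = 3 * sum_list (map \<alpha> p) - 2 * sum_list (map \<beta> p)"
      unfolding f_def by (simp add: sum_list_subtractf sum_list_const_mult)
    finally have c: "sum_list (map c p) = 3 * sum_list (map \<alpha> p) - 2 * sum_list (map \<beta> p)" .
    moreover have "2 dvd sum_list (map \<alpha> p) \<longleftrightarrow> 3 dvd sum_list (map \<beta> p)"
      using walk_graph_balanced_iff[OF _ \<alpha> p] walk_graph_balanced_iff[OF _ \<beta> p] eq by simp
    ultimately show "sum_list (map c p) mod 6 \<in> {0, 1, 5}"
      using mod_6_of_parity by simp
    show "2 dvd sum_list (map c p) \<longleftrightarrow> 2 dvd sum_list (map \<alpha> p)"
      unfolding c by simp
  qed
  \<comment> \<open>Modulo 6, an arc outside \<open>F\<close> has the gain of its fundamental cycle,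
    whose other arcs are zero; \<open>c_sum\<close> restricts that gain.\<close>
  have c_arc: "c a mod 6 \<in> {0, 1, 5}" if a: "a \<in> arcs G" for a
  proof (cases "fst a \<in> F")
    case True
    then show ?thesis using zero[OF a] by (simp add: c_def)
  next
    case False
    obtain p where p: "closed_path (arc_tail a) (a # p)" "fst ` set p \<subseteq> F"
      using arc_in_closed_path[OF F_span a False] .
    have "6 dvd c d" if "d \<in> set p" for d
      using closed_path_arcs[OF p(1)] p(2) zero[of d] that unfolding c_def by auto
    then have "6 dvd sum_list (map c p)"
      by (induction p) auto
    then have "(c a + sum_list (map c p)) mod 6 = c a mod 6"
      by (metis add.right_neutral dvd_imp_mod_0 mod_add_right_eq)
    then show ?thesis
      using c_sum(1)[OF p(1)] by simp
  qed
  have b_mod: "b a mod 6 = c a mod 6" if "a \<in> arcs G" for a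
    using c_arc[OF that] by (auto simp: b_def residue6_def)
  have b_sum_mod: "sum_list (map b p) mod 6 = sum_list (map c p) mod 6" if p: "closed_path u p" for u p
    using closed_path_arcs[OF p] b_mod by (induction p) (auto intro!: mod_add_cong)
  have b_sum: "\<bar>sum_list (map b p)\<bar> \<le> 1" if p: "closed_path u p" for u p
  proof (rule closed_path_sum_le_1[OF F_span _ _ _ p])
    show "b a = 0" if "a \<in> arcs G" "fst a \<in> F" for a
      using zero[OF that] by (simp add: b_def c_def residue6_def)
    show "\<bar>b a\<bar> \<le> 1" for a by (simp add: b_def residue6_def)
    show "sum_list (map b q) mod 6 \<in> {0, 1, 5}" if "closed_path v q" for v q
      using b_sum_mod[OF that] c_sum(1)[OF that] by simp
  qed
  have "b (arc_rev a) = - b a" if a: "a \<in> arcs G" "arc_rev a \<noteq> a" for a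
  proof -
    \<comment> \<open>The potentials cancel, leaving \<open>f a + f (arc_rev a)\<close>.\<close>
    have "6 dvd c a + c (arc_rev a)"
      using f_rev[OF a] by (simp add: c_def algebra_simps)
    then show ?thesis
      using residue6_neg[OF c_arc[OF a(1)]] by (simp add: b_def)
  qed
  moreover have "sum_list (map b p) = 0 \<longleftrightarrow> 2 dvd sum_list (map \<alpha> p)" if p: "closed_path u p" for u p
    using eq_0_of_mod_6[OF b_sum[OF p] b_sum_mod[OF p]] c_sum(2)[OF p] by simp
  ultimately show thesis
    using that b_sum by blast
qed

text \<open>A non-identity element \<open>g\<close> may have any order, even 2, but only the
  exponents -1, 0 and 1 occur on closed paths, and neither \<open>g\<close> nor its inverse is the
  identity.\<close>

lemma gainable_of_integer_gaining:
  fixes b :: "'e \<times> 'v \<times> 'v \<Rightarrow> int" and \<Gamma> (structure)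
  assumes rev: "\<And>a. a \<in> arcs G \<Longrightarrow> arc_rev a \<noteq> a \<Longrightarrow> b (arc_rev a) = - b a"
    and le: "\<And>u p. closed_path u p \<Longrightarrow> \<bar>sum_list (map b p)\<bar> \<le> 1"
    and B: "B = {C. cycle G C \<and> (\<forall>u p. simple_closed_walk C u p \<longrightarrow> sum_list (map b p) = 0)}"
    and "group \<Gamma>" "\<not> trivial_group \<Gamma>"
  shows "gainable \<Gamma> G B"
proof -
  interpret \<Gamma>: group \<Gamma> by fact
  obtain g where g: "g \<in> carrier \<Gamma>" "g \<noteq> \<one>"
    using \<open>\<not> trivial_group \<Gamma>\<close> \<Gamma>.is_group \<Gamma>.one_closed unfolding trivial_group_def by blast
  define \<gamma> where "\<gamma> a = g [^] b a" for a
  have gain: "gain \<Gamma> \<gamma> p = g [^] sum_list (map b p)" for p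
    using g(1) by (induction p) (simp_all add: gain_def \<gamma>_def \<Gamma>.int_pow_mult)
  have "\<gamma> (e, v, u) = inv (\<gamma> (e, u, v))" if "(e, u, v) \<in> arcs G" "\<not> loop G e" for e u v
    using rev[OF that(1)] that g(1) by (auto simp: arcs_def \<gamma>_def \<Gamma>.int_pow_neg)
  then have "gaining \<Gamma> G \<gamma>"
    using g(1) by (auto simp: gaining_def \<gamma>_def)
  moreover have "g [^] sum_list (map b p) = \<one> \<longleftrightarrow> sum_list (map b p) = 0" if "closed_path u p" for u p
  proof -
    have "sum_list (map b p) \<in> {- 1, 0, 1}"
      using le[OF that] by auto
    then show ?thesis using g by (auto simp: \<Gamma>.int_pow_neg)
  qed
  then have "B = gain_balanced \<Gamma> G \<gamma>"
    unfolding B gain_balanced_def gain using simple_closed_walk_closed_path by blast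
  ultimately show ?thesis by (auto simp: gainable_def)
qed

end

section \<open>Copies of groups on other types\<close>

lemma iso_copy:
  fixes \<Gamma> :: "'a monoid" and h :: "'a \<Rightarrow> 'b"
  assumes "group \<Gamma>" and inj: "inj_on h (carrier \<Gamma>)"
  obtains \<Delta> :: "'b monoid" where "group \<Delta>" "h \<in> iso \<Gamma> \<Delta>"
proof -
  interpret \<Gamma>: group \<Gamma> by fact
  define \<Delta> :: "'b monoid" where
    "\<Delta> = \<lparr>carrier = h ` carrier \<Gamma>,
      monoid.mult = (\<lambda>x y. h (inv_into (carrier \<Gamma>) h x \<otimes>\<^bsub>\<Gamma>\<^esub> inv_into (carrier \<Gamma>) h y)),
      one = h \<one>\<^bsub>\<Gamma>\<^esub>\<rparr>"
  have iso: "h \<in> iso \<Gamma> \<Delta>"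
    using inj by (auto simp: iso_def hom_def bij_betw_def \<Delta>_def)
  have "group (\<Delta>\<lparr>one := h \<one>\<^bsub>\<Gamma>\<^esub>\<rparr>)"
    using \<Gamma>.iso_imp_img_group[OF iso] .
  then have "group \<Delta>" by (simp add: \<Delta>_def)
  then show thesis using that iso by blast
qed

text \<open>The cyclic groups of order 2 and 3 live on the integers, while \<open>regular\<close>
  ranges over groups on \<open>'g\<close>. A finite carrier embeds into any infinite type, and the
  group structure is carried along.\<close>

lemma regular_imp_gainable_finite:
  fixes \<Gamma> :: "'a monoid"
  assumes reg: "regular TYPE('g::infinite) G B"
    and \<Gamma>: "group \<Gamma>" "\<not> trivial_group \<Gamma>" "finite (carrier \<Gamma>)"
  shows "gainable \<Gamma> G B"
proof -
  obtain h :: "'a \<Rightarrow> 'g" where "inj_on h (carrier \<Gamma>)"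
    using arb_inj_on_finite_infinite[OF \<Gamma>(3)] by blast
  then obtain \<Delta> :: "'g monoid" where \<Delta>: "group \<Delta>" "h \<in> iso \<Gamma> \<Delta>"
    using iso_copy[OF \<Gamma>(1)] by blast
  have "\<not> trivial_group \<Delta>"
    using \<Gamma>(1,2) \<Delta> isomorphic_group_triviality is_isoI by blast
  then have "gainable \<Delta> G B"
    using reg \<Delta>(1) by (auto simp: regular_def)
  then show ?thesis
    by (rule gainable_iso[OF \<Delta>(1) \<Gamma>(1) group.iso_set_sym[OF \<Gamma>(1) \<Delta>(2)]])
qed

theorem theorem1p4:
  fixes G :: "('v, 'e) graph" and B :: "('v, 'e) graph set"
  assumes "biased_graph G B"
  shows "regular TYPE('g::infinite) G B \<longleftrightarrow>
           gainable (integer_mod_group 2) G B \<and> gainable (integer_mod_group 3) G B"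
proof
  assume "regular TYPE('g) G B"
  then show "gainable (integer_mod_group 2) G B \<and> gainable (integer_mod_group 3) G B"
    by (simp add: regular_imp_gainable_finite trivial_integer_mod_group carrier_integer_mod_group)
next
  assume "gainable (integer_mod_group 2) G B \<and> gainable (integer_mod_group 3) G B"
  then obtain \<alpha> \<beta> where \<alpha>: "gaining (integer_mod_group 2) G \<alpha>" "B = gain_balanced (integer_mod_group 2) G \<alpha>"
    and \<beta>: "gaining (integer_mod_group 3) G \<beta>" "B = gain_balanced (integer_mod_group 3) G \<beta>"
    by (auto simp: gainable_def)
  interpret biased_graph G B by fact
  obtain b :: "'e \<times> 'v \<times> 'v \<Rightarrow> int" where
    b: "\<And>a. a \<in> arcs G \<Longrightarrow> arc_rev a \<noteq> a \<Longrightarrow> b (arc_rev a) = - b a"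
      "\<And>u p. closed_path u p \<Longrightarrow> \<bar>sum_list (map b p)\<bar> \<le> 1"
      "\<And>u p. closed_path u p \<Longrightarrow> sum_list (map b p) = 0 \<longleftrightarrow> 2 dvd sum_list (map \<alpha> p)"
    using integer_gaining[OF \<alpha>(1) \<beta>(1)] \<alpha>(2) \<beta>(2) by blast
  \<comment> \<open>The integer gain vanishes on the same simple closed walks as the gain modulo 2,
    which describes \<open>B\<close> by \<open>b\<close> alone.\<close>
  have "gain (integer_mod_group 2) \<alpha> p = 0 \<longleftrightarrow> sum_list (map b p) = 0"
    if "cycle G C" "simple_closed_walk C u p" for C u p
    using b(3)[OF simple_closed_walk_closed_path[OF that]]
    by (simp add: gain_integer_mod_group dvd_eq_mod_eq_0)
  then have "B = {C. cycle G C \<and> (\<forall>u p. simple_closed_walk C u p \<longrightarrow> sum_list (map b p) = 0)}"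
    unfolding \<alpha>(2) gain_balanced_def by auto
  then have "gainable \<Gamma> G B" if "group \<Gamma>" "\<not> trivial_group \<Gamma>" for \<Gamma> :: "'g monoid"
    using gainable_of_integer_gaining[of b B \<Gamma>] b that by simp
  then show "regular TYPE('g) G B"
    by (simp add: regular_def)
qed

end
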